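(* Let $q$ be a prime power, $\mathbb{F}_q$ the field with $q$ elements, and let $e,d$ be integers with $e>d>0$. Let $g\in\mathbb{F}_q[T]$ be monic of degree $e$ with factorization pattern $(\lambda_1,\ldots,\lambda_e)$, and let $k$ be the least index with $\lambda_k>0$. Let $\lambda_k^*$ be the number of distinct monic irreducible factors of $g$ of degree $k$. Let $\mathcal{X}_g:\mathbb{F}_q[T]_d\to\{0,\ldots,d\}$, $\mathcal{X}_g(f)=\deg\gcd(g,f)$, where $\mathbb{F}_q[T]_d$ (the set of monic polynomials of degree $d$ in $\mathbb{F}_q[T]$) carries the uniform probability. If $k\le d$, then $$\frac{k\,\lambda_k^*}{q^k}-\binom{\lambda_k^*}{2}\frac{k}{q^{\min\{2k,d\}}}\le E[\mathcal{X}_g]\le \frac{k\,\lambda_k^*}{q^k}+\sum_{i=k+1}^d\frac{i}{q^i}\sum_{\substack{h_k\le\lambda_k,\ldots,\,h_i\le\lambda_i\\ k\,h_k+\cdots+i\,h_i=i}}\binom{\lambda_k}{h_k}\cdots\binom{\lambda_i}{h_i},$$ where the inner sum runs over tuples $(h_k,\ldots,h_i)$ of nonnegative integers.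
   Context: $g$ has factorization pattern $(\lambda_1,\ldots,\lambda_e)$ (with $\lambda_1+2\lambda_2+\cdots+e\lambda_e=e$) if $g$ has exactly $\lambda_i$ monic irreducible factors in $\mathbb{F}_q[T]$ of degree $i$, counted with multiplicity, for $1\le i\le e$. $E[\cdot]$ denotes expected value. *)

theory Defs
  imports
    "HOL-Probability.Probability"
    "HOL-Computational_Algebra.Computational_Algebra"
begin

text \<open>
  The field with \<open>q\<close> elements is a type \<open>'a :: {finite, field_gcd}\<close> with \<open>CARD('a) = q\<close>.
  Class \<^class>\<open>field_gcd\<close> only adds to \<^class>\<open>field\<close> the (trivial) gcd and normalization
  operations on the field itself that the library requires for \<open>gcd\<close> on \<open>'a poly\<close>; every field
  can be equipped with them. The gcd of polynomials is then the usual monic one.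
\<close>

definition monic_polys :: "nat \<Rightarrow> 'a::field poly set" where
  "monic_polys d = {f. lead_coeff f = 1 \<and> degree f = d}"

definition monic_irred_factors :: "'a::field poly \<Rightarrow> nat \<Rightarrow> 'a poly set" where
  "monic_irred_factors g i = {p \<in> monic_polys i. irreducible p \<and> p dvd g}"

text \<open>
  A pattern is a function on \<open>nat\<close> of which only the values at \<open>1, \<dots>, degree g\<close> are relevant.
\<close>

definition factorization_pattern :: "'a::field_gcd poly \<Rightarrow> (nat \<Rightarrow> nat) \<Rightarrow> bool" where
  "factorization_pattern g lam \<longleftrightarrow>
     (\<Sum>i=1..degree g. i * lam i) = degree g \<and>
     (\<forall>i\<in>{1..degree g}. lam i = (\<Sum>p\<in>monic_irred_factors g i. multiplicity p g))"

definition gcd_degree :: "'a::field_gcd poly \<Rightarrow> 'a poly \<Rightarrow> nat" where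
  "gcd_degree g f = degree (gcd g f)"

text \<open>
  The tuples \<open>(h\<^sub>k, \<dots>, h\<^sub>i)\<close> as extensional functions on \<open>{k..i}\<close>, so that each tuple occurs
  exactly once.
\<close>

definition sub_patterns :: "(nat \<Rightarrow> nat) \<Rightarrow> nat \<Rightarrow> nat \<Rightarrow> (nat \<Rightarrow> nat) set" where
  "sub_patterns lam k i = {h \<in> (\<Pi>\<^sub>E j\<in>{k..i}. {0..lam j}). (\<Sum>j=k..i. j * h j) = i}"

end

theory Submission
  imports Defs
begin

text \<open>
  A monic \<open>m\<close> of degree \<open>i \<le> d\<close> divides exactly \<open>q ^ (d - i)\<close> of the monic polynomials of degree
  \<open>d\<close>. Lower bound: \<open>deg (gcd g f)\<close> is at least \<open>k\<close> times the number of degree-\<open>k\<close> irreducible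
  factors of \<open>g\<close> dividing \<open>f\<close>, so the expectation is already at least \<open>k lamstar / q ^ k\<close>, without
  the correction term. Upper bound: \<open>deg (gcd g f)\<close> is at most the sum of the degrees of all monic
  common divisors of \<open>g\<close> and \<open>f\<close>, so it remains to count the monic divisors of \<open>g\<close> of each degree.
\<close>

section \<open>Monic polynomials, normalization and prime factors\<close>

lemma normalize_monic:
  fixes p :: "'a::field_gcd poly"
  assumes "lead_coeff p = 1"
  shows "normalize p = p"
  using assms by (simp add: normalize_poly_eq_map_poly map_poly_idI)

lemma lead_coeff_normalized:
  fixes p :: "'a::field_gcd poly"
  assumes "normalize p = p" "p \<noteq> 0"
  shows "lead_coeff p = 1"
proof -
  have "lead_coeff p = coeff (normalize p) (degree p)"
    by (simp add: assms(1))
  also have "\<dots> = lead_coeff p div unit_factor (lead_coeff p)"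
    by (simp only: coeff_normalize)
  \<comment> \<open>A nonzero field element is a unit and hence its own
    \<open>unit_factor\<close>.\<close>
  also have "\<dots> = 1"
    using assms(2) by (simp add: is_unit_unit_factor dvd_field_iff)
  finally show ?thesis .
qed

lemma degree_eq_sum_prime_factors:
  fixes p :: "'a::field_gcd poly"
  assumes "lead_coeff p = 1"
  shows "degree p = (\<Sum>r\<in>prime_factors p. multiplicity r p * degree r)"
proof -
  have "p \<noteq> 0" using assms by auto
  then have "p = (\<Prod>r\<in>prime_factors p. r ^ multiplicity r p)"
    using assms by (simp add: prod_prime_factors normalize_monic)
  then have "degree p = degree (\<Prod>r\<in>prime_factors p. r ^ multiplicity r p)"
    by simp
  also have "\<dots> = (\<Sum>r\<in>prime_factors p. degree (r ^ multiplicity r p))"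
    by (rule degree_prod_sum_eq) auto
  also have "\<dots> = (\<Sum>r\<in>prime_factors p. multiplicity r p * degree r)"
    by (intro sum.cong refl degree_power_eq) auto
  finally show ?thesis .
qed

text \<open>Library primes are normalized, which for nonzero polynomials means monic. This gives the
  sets behind \<open>factorization_pattern\<close> access to the theory of
  \<open>prime_factors\<close>.\<close>

lemma monic_irred_factors_conv_prime_factors:
  fixes g :: "'a::field_gcd poly"
  assumes "g \<noteq> 0"
  shows "monic_irred_factors g i = {p \<in> prime_factors g. degree p = i}"
  using assms
  by (auto simp: monic_irred_factors_def monic_polys_def in_prime_factors_iff prime_def
      prime_elem_iff_irreducible normalize_monic intro!: lead_coeff_normalized)

section \<open>Counting monic polynomials and monic multiples\<close>

lemma monic_polys_Suc:
  "monic_polys (Suc n) = (\<lambda>(a, f). pCons a f) ` (UNIV \<times> monic_polys n)"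
proof (intro equalityI subsetI)
  fix f :: "'a poly" assume f: "f \<in> monic_polys (Suc n)"
  obtain a h where ah: "f = pCons a h" by (cases f)
  with f have "h \<in> monic_polys n"
    by (auto simp: monic_polys_def split: if_splits)
  with ah show "f \<in> (\<lambda>(a, f). pCons a f) ` (UNIV \<times> monic_polys n)" by auto
qed (auto simp: monic_polys_def)

lemma finite_monic_polys: "finite (monic_polys n :: 'a::{finite, field} poly set)"
  and card_monic_polys: "card (monic_polys n :: 'a::{finite, field} poly set) = CARD('a) ^ n"
proof (induction n)
  case 0
  have "monic_polys 0 = {1 :: 'a poly}"
    by (auto simp: monic_polys_def elim!: degree_eq_zeroE)
  then show "finite (monic_polys 0 :: 'a poly set)"
    "card (monic_polys 0 :: 'a poly set) = CARD('a) ^ 0" by auto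
next
  case (Suc n)
  have "inj_on (\<lambda>(a, f). pCons a f) (UNIV \<times> (monic_polys n :: 'a poly set))"
    by (auto simp: inj_on_def)
  with Suc show "finite (monic_polys (Suc n) :: 'a poly set)"
    "card (monic_polys (Suc n) :: 'a poly set) = CARD('a) ^ Suc n"
    by (auto simp: monic_polys_Suc card_image card_cartesian_product)
qed

text \<open>Multiplication by \<open>m\<close> is a bijection from the monic polynomials of degree
  \<open>d - i\<close> onto these multiples. For \<open>i > d\<close> the truncated exponent would
  give 1 although no multiple exists.\<close>

lemma card_monic_multiples:
  fixes m :: "'a::{finite, field} poly"
  assumes "m \<in> monic_polys i" "i \<le> d"
  shows "card {f \<in> monic_polys d. m dvd f} = CARD('a) ^ (d - i)"
proof -
  have m: "lead_coeff m = 1" "degree m = i" "m \<noteq> 0"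
    using assms by (auto simp: monic_polys_def)
  have "{f \<in> monic_polys d. m dvd f} = (*) m ` monic_polys (d - i)"
  proof (intro equalityI subsetI)
    fix f assume f: "f \<in> {f \<in> monic_polys d. m dvd f}"
    then obtain h where h: "f = m * h" by auto
    with f have "h \<noteq> 0" by (auto simp: monic_polys_def)
    with f h m have "h \<in> monic_polys (d - i)"
      by (auto simp: monic_polys_def lead_coeff_mult degree_mult_eq coeff_mult_degree_sum)
    with h show "f \<in> (*) m ` monic_polys (d - i)" by auto
  next
    fix f assume "f \<in> (*) m ` monic_polys (d - i)"
    then obtain h where "f = m * h" "h \<in> monic_polys (d - i)" by blast
    then have h: "f = m * h" "lead_coeff h = 1" "degree h = d - i"
      by (auto simp: monic_polys_def)
    then have "h \<noteq> 0" by auto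
    then have "degree f = d" using h m assms by (simp add: degree_mult_eq)
    moreover have "lead_coeff f = 1" using h(1,2) m(1) by (simp only: lead_coeff_mult mult_1)
    ultimately show "f \<in> {f \<in> monic_polys d. m dvd f}"
      using h by (auto simp: monic_polys_def)
  qed
  moreover have "inj_on ((*) m) (monic_polys (d - i))"
    using m by (auto simp: inj_on_def)
  ultimately show ?thesis by (simp add: card_image card_monic_polys)
qed

text \<open>Double counting of the pairs \<open>(m, f)\<close> with \<open>m dvd f\<close>.\<close>

lemma sum_card_divisors:
  fixes D :: "'a::{finite, field} poly set"
  assumes "D \<subseteq> monic_polys i" "i \<le> d"
  shows "(\<Sum>f\<in>monic_polys d. card {m \<in> D. m dvd f}) = card D * CARD('a) ^ (d - i)"
proof -
  have fin: "finite D" by (rule finite_subset[OF assms(1) finite_monic_polys])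
  have "(\<Sum>f\<in>monic_polys d. card {m \<in> D. m dvd f}) = (\<Sum>m\<in>D. card {f \<in> monic_polys d. m dvd f})"
    by (intro sum_multicount_gen fin finite_monic_polys ballI refl)
  also have "\<dots> = (\<Sum>m\<in>D. CARD('a) ^ (d - i))"
    using assms by (intro sum.cong refl card_monic_multiples) auto
  finally show ?thesis by simp
qed

section \<open>Pointwise bounds for the degree of the gcd\<close>

definition monic_divisors :: "'a::field poly \<Rightarrow> nat \<Rightarrow> 'a poly set" where
  "monic_divisors g i = {m \<in> monic_polys i. m dvd g}"

lemma gcd_in_monic_divisors:
  fixes g f :: "'a::field_gcd poly"
  assumes "g \<noteq> 0"
  shows "gcd g f \<in> monic_divisors g (degree (gcd g f))"
  using assms by (auto simp: monic_divisors_def monic_polys_def intro!: lead_coeff_normalized)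

lemma degree_prime_factors_le_degree:
  fixes m :: "'a::field_gcd poly"
  assumes "m \<noteq> 0" "r \<in> prime_factors m"
  shows "degree r \<le> degree m"
  using assms by (auto intro!: dvd_imp_degree_le)

lemma degree_prime_pos:
  fixes r :: "'a::field_gcd poly"
  assumes "prime r"
  shows "degree r > 0"
  using assms by (metis gr0I is_unit_iff_degree not_prime_0 not_prime_unit)

text \<open>The factors counted are exactly the degree-\<open>k\<close> primes of
  \<open>gcd g f\<close>. In the degree formula for the gcd each of them contributes at least
  \<open>k\<close>, and the other primes contribute nonnegatively.\<close>

lemma mult_card_irred_factors_le_gcd_degree:
  fixes g f :: "'a::field_gcd poly"
  assumes "g \<noteq> 0"
  shows "k * card {p \<in> monic_irred_factors g k. p dvd f} \<le> gcd_degree g f"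
proof -
  let ?c = "gcd g f" and ?P = "{p \<in> monic_irred_factors g k. p dvd f}"
  have c: "?c \<noteq> 0" using assms by simp
  have P: "?P = {p \<in> prime_factors ?c. degree p = k}"
    using assms by (auto simp: monic_irred_factors_conv_prime_factors in_prime_factors_iff)
  have "k * card ?P = (\<Sum>p\<in>?P. k)" by simp
  also have "\<dots> \<le> (\<Sum>p\<in>?P. multiplicity p ?c * degree p)"
  proof (rule sum_mono)
    fix p assume "p \<in> ?P"
    then have "p \<in> prime_factors ?c" "degree p = k" unfolding P by auto
    then have "multiplicity p ?c > 0" by (simp add: prime_factors_multiplicity)
    with \<open>degree p = k\<close> show "k \<le> multiplicity p ?c * degree p" by simp
  qed
  also have "\<dots> \<le> (\<Sum>p\<in>prime_factors ?c. multiplicity p ?c * degree p)"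
    by (rule sum_mono2) (auto simp: P)
  also have "\<dots> = degree ?c"
    using c by (intro degree_eq_sum_prime_factors[symmetric] lead_coeff_normalized) auto
  finally show ?thesis by (simp add: gcd_degree_def)
qed

text \<open>The gcd is itself one of the divisors counted, and its degree is at most
  \<open>d\<close> since it divides \<open>f\<close>. So the single summand at
  \<open>i = gcd_degree g f\<close> is already large enough.\<close>

lemma gcd_degree_le_sum_card_divisors:
  fixes g f :: "'a::{finite, field_gcd} poly"
  assumes "g \<noteq> 0" "f \<in> monic_polys d"
  shows "gcd_degree g f \<le> (\<Sum>i=1..d. i * card {m \<in> monic_divisors g i. m dvd f})"
proof (cases "gcd_degree g f = 0")
  case False
  let ?n = "gcd_degree g f"
  have "finite {m \<in> monic_divisors g ?n. m dvd f}"
    by (rule finite_subset[OF _ finite_monic_polys[of ?n]]) (auto simp: monic_divisors_def)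
  moreover have "gcd g f \<in> {m \<in> monic_divisors g ?n. m dvd f}"
    using gcd_in_monic_divisors[OF assms(1)] by (simp add: gcd_degree_def)
  ultimately have "card {m \<in> monic_divisors g ?n. m dvd f} > 0"
    by (auto simp: card_gt_0_iff)
  then have "?n \<le> ?n * card {m \<in> monic_divisors g ?n. m dvd f}" by simp
  also have "\<dots> \<le> (\<Sum>i=1..d. i * card {m \<in> monic_divisors g i. m dvd f})"
  proof (rule member_le_sum)
    have "degree (gcd g f) \<le> degree f"
      using assms by (intro dvd_imp_degree_le) (auto simp: monic_polys_def)
    then show "?n \<in> {1..d}"
      using False assms by (auto simp: gcd_degree_def monic_polys_def)
  qed auto
  finally show ?thesis .
qed simp

section \<open>Counting the monic divisors of a given degree\<close>

text \<open>Splitting \<open>I\<close> by weight injects the weight-\<open>i\<close> subsets into tuples of subsets of the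
  weight classes; a tuple with cardinalities \<open>h\<close> can be chosen in \<open>\<Prod>\<^sub>j (lam j choose h j)\<close> ways.\<close>

lemma card_weighted_subsets_le:
  fixes S :: "'b set" and w :: "'b \<Rightarrow> nat"
  assumes fin: "finite S"
    and w: "\<And>x. x \<in> S \<Longrightarrow> k \<le> w x"
    and lam: "\<And>j. j \<in> {k..i} \<Longrightarrow> card {x \<in> S. w x = j} = lam j"
  shows "card {I. I \<subseteq> S \<and> (\<Sum>x\<in>I. w x) = i} \<le> (\<Sum>h\<in>sub_patterns lam k i. \<Prod>j=k..i. lam j choose h j)"
proof -
  define L where "L j = {x \<in> S. w x = j}" for j
  define T where
    "T = (SIGMA h:sub_patterns lam k i. \<Pi>\<^sub>E j\<in>{k..i}. {A. A \<subseteq> L j \<and> card A = h j})"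
  \<comment> \<open>The first component sorts the tuples of subsets by their cardinalities, so that
    \<open>card T\<close> becomes a sum over \<open>h\<close>.\<close>
  define F where "F I = ((\<lambda>j\<in>{k..i}. card (I \<inter> L j)), (\<lambda>j\<in>{k..i}. I \<inter> L j))" for I
  let ?W = "{I. I \<subseteq> S \<and> (\<Sum>x\<in>I. w x) = i}"
  have finL: "finite (L j)" for j using fin by (simp add: L_def)
  \<comment> \<open>No weight in \<open>I\<close> exceeds the total \<open>i\<close>, so the classes
    \<open>k..i\<close> exhaust \<open>I\<close>.\<close>
  have cover: "I = (\<Union>j\<in>{k..i}. I \<inter> L j)" if "I \<in> ?W" for I
  proof -
    have "w x \<in> {k..i}" if "x \<in> I" for x
    proof -
      have "finite I" using \<open>I \<in> ?W\<close> fin by (auto intro: finite_subset)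
      then have "w x \<le> (\<Sum>x\<in>I. w x)" using that by (intro member_le_sum) auto
      then show ?thesis using \<open>I \<in> ?W\<close> that w by auto
    qed
    then show ?thesis using \<open>I \<in> ?W\<close> by (auto simp: L_def)
  qed
  have "inj_on F ?W"
  proof (rule inj_onI)
    fix I J assume IJ: "I \<in> ?W" "J \<in> ?W" "F I = F J"
    then have eq: "(\<lambda>j\<in>{k..i}. I \<inter> L j) = (\<lambda>j\<in>{k..i}. J \<inter> L j)" by (simp add: F_def)
    have "I \<inter> L j = J \<inter> L j" if "j \<in> {k..i}" for j
      using fun_cong[OF eq, of j] that by simp
    then show "I = J" using cover[OF IJ(1)] cover[OF IJ(2)] by simp
  qed
  moreover have "F ` ?W \<subseteq> T"
  proof (intro image_subsetI)
    fix I assume I: "I \<in> ?W"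
    then have finI: "finite I" using fin by (auto intro: finite_subset)
    have "i = (\<Sum>x\<in>(\<Union>j\<in>{k..i}. I \<inter> L j). w x)"
      using I cover[OF I] by auto
    also have "\<dots> = (\<Sum>j=k..i. \<Sum>x\<in>I \<inter> L j. w x)"
      using finI by (intro sum.UNION_disjoint) (auto simp: L_def)
    also have "\<dots> = (\<Sum>j=k..i. \<Sum>x\<in>I \<inter> L j. j)"
      by (intro sum.cong refl) (auto simp: L_def)
    also have "\<dots> = (\<Sum>j=k..i. j * card (I \<inter> L j))"
      by (simp add: mult.commute)
    finally have "(\<Sum>j=k..i. j * card (I \<inter> L j)) = i" by simp
    moreover have "card (I \<inter> L j) \<le> lam j" if "j \<in> {k..i}" for j
      using card_mono[OF finL, of "I \<inter> L j" j] lam[OF that] by (simp add: L_def)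
    ultimately show "F I \<in> T"
      by (auto simp: F_def T_def sub_patterns_def PiE_iff)
  qed
  moreover have finSP: "finite (sub_patterns lam k i)"
    unfolding sub_patterns_def
    by (rule finite_subset[OF _ finite_PiE[of "{k..i}" "\<lambda>j. {0..lam j}"]]) auto
  moreover have finE: "finite (\<Pi>\<^sub>E j\<in>{k..i}. {A. A \<subseteq> L j \<and> card A = h j})" for h
    using finL by (intro finite_PiE) auto
  ultimately have "card ?W \<le> card T"
    unfolding T_def by (intro card_inj_on_le[of F]) auto
  also have "card T = (\<Sum>h\<in>sub_patterns lam k i. card (\<Pi>\<^sub>E j\<in>{k..i}. {A. A \<subseteq> L j \<and> card A = h j}))"
    unfolding T_def using finSP finE by (intro card_SigmaI) auto
  also have "\<dots> = (\<Sum>h\<in>sub_patterns lam k i. \<Prod>j=k..i. lam j choose h j)"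
    using lam finL by (intro sum.cong refl) (auto simp: card_PiE n_subsets L_def intro!: prod.cong)
  finally show ?thesis .
qed

text \<open>A monic divisor \<open>m\<close> is encoded as the set of pairs \<open>(p, t)\<close> with \<open>t < multiplicity p m\<close>, a
  subset of the corresponding set for \<open>g\<close>.\<close>

lemma card_monic_divisors_le:
  fixes g :: "'a::field_gcd poly"
  assumes g: "g \<noteq> 0"
    and min: "\<And>p. p \<in> prime_factors g \<Longrightarrow> k \<le> degree p"
    and lam: "\<And>j. j \<in> {k..i} \<Longrightarrow> lam j = (\<Sum>p\<in>monic_irred_factors g j. multiplicity p g)"
  shows "card (monic_divisors g i) \<le> (\<Sum>h\<in>sub_patterns lam k i. \<Prod>j=k..i. lam j choose h j)"
proof -
  define E where "E m = (SIGMA p:prime_factors g. {..<multiplicity p m})" for m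
  define w :: "'a poly \<times> nat \<Rightarrow> nat" where "w x = degree (fst x)" for x
  let ?W = "{I. I \<subseteq> E g \<and> (\<Sum>x\<in>I. w x) = i}"
  have sub: "prime_factors m \<subseteq> prime_factors g" if "m dvd g" for m
    using that g by (auto simp: in_prime_factors_iff intro: dvd_trans)
  \<comment> \<open>Both formulas run over the primes of \<open>g\<close>, with exponent 0 at those
    not dividing \<open>m\<close>, so that all divisors share one index set.\<close>
  have prod: "m = (\<Prod>p\<in>prime_factors g. p ^ multiplicity p m)"
    and deg: "degree m = (\<Sum>p\<in>prime_factors g. multiplicity p m * degree p)"
    if m: "m \<in> monic_divisors g i" for m
  proof -
    have m': "lead_coeff m = 1" "m dvd g" "m \<noteq> 0"
      using m by (auto simp: monic_divisors_def monic_polys_def)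
    have zero: "multiplicity p m = 0" if "p \<in> prime_factors g - prime_factors m" for p
      using that m' by (auto simp: prime_factors_multiplicity)
    have "m = (\<Prod>p\<in>prime_factors m. p ^ multiplicity p m)"
      using m' by (simp add: prod_prime_factors normalize_monic)
    also have "\<dots> = (\<Prod>p\<in>prime_factors g. p ^ multiplicity p m)"
      using sub[OF m'(2)] zero by (intro prod.mono_neutral_left) auto
    finally show "m = (\<Prod>p\<in>prime_factors g. p ^ multiplicity p m)" .
    have "degree m = (\<Sum>p\<in>prime_factors m. multiplicity p m * degree p)"
      using m' by (intro degree_eq_sum_prime_factors)
    also have "\<dots> = (\<Sum>p\<in>prime_factors g. multiplicity p m * degree p)"
      using sub[OF m'(2)] zero by (intro sum.mono_neutral_left) auto
    finally show "degree m = (\<Sum>p\<in>prime_factors g. multiplicity p m * degree p)" .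
  qed
  have "inj_on E (monic_divisors g i)"
  proof (rule inj_onI)
    fix m n assume mn: "m \<in> monic_divisors g i" "n \<in> monic_divisors g i" "E m = E n"
    have "multiplicity p m = multiplicity p n" if "p \<in> prime_factors g" for p
    proof -
      \<comment> \<open>The fibre of \<open>E m\<close> over \<open>p\<close> is an initial segment,
        which determines the multiplicity.\<close>
      have "{..<multiplicity p m} = E m `` {p}" "{..<multiplicity p n} = E n `` {p}"
        using that by (auto simp: E_def)
      with mn(3) show ?thesis by (metis lessThan_eq_iff)
    qed
    then show "m = n" using prod[OF mn(1)] prod[OF mn(2)] by simp
  qed
  moreover have "E ` monic_divisors g i \<subseteq> ?W"
  proof (intro image_subsetI)
    fix m assume m: "m \<in> monic_divisors g i"
    then have "multiplicity p m \<le> multiplicity p g" for p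
      using g by (intro dvd_imp_multiplicity_le) (auto simp: monic_divisors_def)
    then have "E m \<subseteq> E g" by (auto simp: E_def intro: less_le_trans)
    moreover have "(\<Sum>x\<in>E m. w x) = degree m"
      unfolding deg[OF m] E_def w_def
      using sum.Sigma[of "prime_factors g" "\<lambda>p. {..<multiplicity p m}" "\<lambda>p _. degree p"]
      by (simp add: case_prod_unfold)
    ultimately show "E m \<in> ?W" using m by (auto simp: monic_divisors_def monic_polys_def)
  qed
  moreover have finE: "finite (E g)" by (simp add: E_def)
  ultimately have "card (monic_divisors g i) \<le> card ?W"
    by (intro card_inj_on_le[of E]) auto
  also have "\<dots> \<le> (\<Sum>h\<in>sub_patterns lam k i. \<Prod>j=k..i. lam j choose h j)"
  proof (rule card_weighted_subsets_le[OF finE])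
    show "k \<le> w x" if "x \<in> E g" for x using that min by (auto simp: E_def w_def)
    show "card {x \<in> E g. w x = j} = lam j" if "j \<in> {k..i}" for j
    proof -
      \<comment> \<open>The class of weight \<open>j\<close> has one element per
        degree-\<open>j\<close> prime factor counted with multiplicity, which is
        \<open>lam j\<close>.\<close>
      have "{x \<in> E g. w x = j} = (SIGMA p:monic_irred_factors g j. {..<multiplicity p g})"
        using g by (auto simp: E_def w_def monic_irred_factors_conv_prime_factors)
      then show ?thesis
        using lam[OF that] g by (simp add: monic_irred_factors_conv_prime_factors)
    qed
  qed
  finally show ?thesis .
qed

section \<open>Divisors of degree at most the least prime degree\<close>

lemma exists_prime_factor_of_divisor:
  fixes g :: "'a::field_gcd poly"
  assumes "g \<noteq> 0" "m \<in> monic_divisors g i" "i > 0"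
  obtains r where "r \<in> prime_factors g" "r dvd m" "degree r \<le> i"
proof -
  have m: "m dvd g" "m \<noteq> 0" "degree m = i"
    using assms by (auto simp: monic_divisors_def monic_polys_def)
  then have "\<not> is_unit m" using assms by (simp add: is_unit_iff_degree)
  then obtain r where "prime r" "r dvd m" using m by (metis prime_divisor_exists)
  then show ?thesis
    using that[of r] m assms by (auto simp: in_prime_factors_iff intro: dvd_trans dvd_imp_degree_le)
qed

lemma monic_divisors_below_min_degree:
  fixes g :: "'a::field_gcd poly"
  assumes "g \<noteq> 0" "\<And>p. p \<in> prime_factors g \<Longrightarrow> k \<le> degree p" "0 < i" "i < k"
  shows "monic_divisors g i = {}"
  using assms by (metis equals0I exists_prime_factor_of_divisor leD le_trans)

text \<open>A prime factor of such a divisor already has degree \<open>k\<close>, so the cofactor is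
  a monic constant, that is 1. This makes the term \<open>i = k\<close> of the upper bound count
  distinct factors, as \<open>lamstar\<close> does.\<close>

lemma monic_divisors_min_degree:
  fixes g :: "'a::field_gcd poly"
  assumes "g \<noteq> 0" "\<And>p. p \<in> prime_factors g \<Longrightarrow> k \<le> degree p" "0 < k"
  shows "monic_divisors g k = monic_irred_factors g k"
proof (intro equalityI subsetI)
  fix m assume m: "m \<in> monic_divisors g k"
  obtain r where r: "r \<in> prime_factors g" "r dvd m" "degree r \<le> k"
    using exists_prime_factor_of_divisor[OF assms(1) m assms(3)] .
  have degr: "degree r = k" using r assms(2) by (simp add: antisym)
  have lcr: "lead_coeff r = 1" using r(1) by (intro lead_coeff_normalized normalize_prime) auto
  have m': "lead_coeff m = 1" "degree m = k" using m by (auto simp: monic_divisors_def monic_polys_def)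
  obtain s where s: "m = r * s" using r(2) by auto
  have "s \<noteq> 0" "r \<noteq> 0" using s m' by auto
  then have "degree s = 0" using s m' degr by (simp add: degree_mult_eq)
  moreover have "lead_coeff s = 1" using m'(1) lcr unfolding s by (simp only: lead_coeff_mult mult_1)
  ultimately have "s = 1" by (auto elim!: degree_eq_zeroE)
  with s r degr assms(1) show "m \<in> monic_irred_factors g k"
    by (simp add: monic_irred_factors_conv_prime_factors)
qed (auto simp: monic_irred_factors_def monic_divisors_def)

section \<open>Averaging the pointwise bounds over all monic polynomials of degree
  \<open>d\<close>\<close>

theorem theorem4p5:
  fixes g :: "'a::{finite, field_gcd} poly"
    and lam :: "nat \<Rightarrow> nat"
    and q e d k lamstar :: nat
  assumes "CARD('a) = q"
    and "0 < d" and "d < e"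
    and "lead_coeff g = 1" and "degree g = e"
    and "factorization_pattern g lam"
    and "k = (LEAST i. i \<in> {1..e} \<and> lam i > 0)"
    and "lamstar = card (monic_irred_factors g k)"
    and "k \<le> d"
  shows "real k * real lamstar / real q ^ k
           - real (lamstar choose 2) * (real k / real q ^ min (2 * k) d)
         \<le> measure_pmf.expectation (pmf_of_set (monic_polys d)) (\<lambda>f. real (gcd_degree g f))
         \<and> measure_pmf.expectation (pmf_of_set (monic_polys d)) (\<lambda>f. real (gcd_degree g f))
         \<le> real k * real lamstar / real q ^ k
           + (\<Sum>i=k+1..d. real i / real q ^ i
               * (\<Sum>h\<in>sub_patterns lam k i. \<Prod>j=k..i. real (lam j choose h j)))"
proof -
  define M where "M = (monic_polys d :: 'a poly set)"
  let ?E = "measure_pmf.expectation (pmf_of_set M) (\<lambda>f. real (gcd_degree g f))"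
  let ?B = "\<lambda>i. \<Sum>h\<in>sub_patterns lam k i. \<Prod>j=k..i. real (lam j choose h j)"
  have g: "g \<noteq> 0" using assms by auto
  have q: "q > 0" using assms(1) by auto
  have lam: "lam i = (\<Sum>p\<in>monic_irred_factors g i. multiplicity p g)" if "i \<in> {1..e}" for i
    using assms that by (auto simp: factorization_pattern_def)
  \<comment> \<open>The weighted sum of the pattern is \<open>e > 0\<close>, so some entry is
    positive and \<open>LEAST\<close> is attained.\<close>
  have kex: "\<exists>i. i \<in> {1..e} \<and> lam i > 0"
  proof (rule ccontr)
    assume "\<not> ?thesis"
    then have "(\<Sum>i=1..e. i * lam i) = 0" by auto
    then show False using assms by (simp add: factorization_pattern_def)
  qed
  then have k: "k \<in> {1..e}" using LeastI_ex[OF kex] assms(7) by simp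
  \<comment> \<open>A prime factor \<open>p\<close> contributes its positive multiplicity to
    \<open>lam (degree p)\<close>, so \<open>degree p\<close> competes in the minimum defining
    \<open>k\<close>.\<close>
  have kmin: "k \<le> degree p" if p: "p \<in> prime_factors g" for p
  proof -
    have deg: "degree p \<in> {1..e}"
      using degree_prime_factors_le_degree[OF g p] degree_prime_pos[of p] p assms(5)
      by (simp add: in_prime_factors_iff Suc_le_eq)
    have "p \<in> monic_irred_factors g (degree p)"
      using p g by (simp add: monic_irred_factors_conv_prime_factors)
    moreover have "multiplicity p g > 0" using p by (simp add: prime_factors_multiplicity)
    moreover have "finite (monic_irred_factors g (degree p))"
      using g by (simp add: monic_irred_factors_conv_prime_factors)
    ultimately have "lam (degree p) > 0" unfolding lam[OF deg]
      by (intro sum_pos2[of _ p]) auto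
    with deg show ?thesis unfolding assms(7) by (intro Least_le) auto
  qed
  have cardM: "card M = q ^ d" using assms(1) by (simp add: M_def card_monic_polys)
  have finM: "finite M" by (simp add: M_def finite_monic_polys)
  have "M \<noteq> {}" using cardM q by auto
  then have E: "?E = real (\<Sum>f\<in>M. gcd_degree g f) / real q ^ d"
    using finM cardM by (simp add: integral_pmf_of_set)
  \<comment> \<open>A fixed monic polynomial of degree \<open>i\<close> divides a random
    \<open>f\<close> with probability \<open>1 / q ^ i\<close>.\<close>
  have scale: "real (i * (n * q ^ (d - i))) / real q ^ d = real i / real q ^ i * real n"
    if "i \<le> d" for i n
  proof -
    have "real q ^ d = real q ^ i * real q ^ (d - i)"
      using that by (simp flip: power_add)
    then show ?thesis using q by simp
  qed

  have "real k * real lamstar / real q ^ k = real (k * (lamstar * q ^ (d - k))) / real q ^ d"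
    using scale[OF assms(9)] by simp
  also have "k * (lamstar * q ^ (d - k)) = (\<Sum>f\<in>M. k * card {p \<in> monic_irred_factors g k. p dvd f})"
    unfolding M_def sum_distrib_left[symmetric] using assms
    by (subst sum_card_divisors) (auto simp: monic_irred_factors_def)
  also have "real \<dots> / real q ^ d \<le> ?E"
    unfolding E using g q
    by (intro divide_right_mono of_nat_mono sum_mono mult_card_irred_factors_le_gcd_degree) auto
  finally have lower: "real k * real lamstar / real q ^ k \<le> ?E" .

  have "(\<Sum>f\<in>M. gcd_degree g f) \<le> (\<Sum>f\<in>M. \<Sum>i=1..d. i * card {m \<in> monic_divisors g i. m dvd f})"
    using g by (intro sum_mono gcd_degree_le_sum_card_divisors) (auto simp: M_def)
  also have "\<dots> = (\<Sum>i=1..d. i * (\<Sum>f\<in>M. card {m \<in> monic_divisors g i. m dvd f}))"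
    by (subst sum.swap) (simp add: sum_distrib_left)
  also have "\<dots> = (\<Sum>i=1..d. i * (card (monic_divisors g i) * q ^ (d - i)))"
    unfolding M_def assms(1)[symmetric]
    by (intro sum.cong refl arg_cong2[of _ _ _ _ "(*)"] sum_card_divisors)
      (auto simp: monic_divisors_def)
  finally have "?E \<le> real (\<Sum>i=1..d. i * (card (monic_divisors g i) * q ^ (d - i))) / real q ^ d"
    unfolding E by (intro divide_right_mono of_nat_mono) auto
  also have "\<dots> = (\<Sum>i=1..d. real i / real q ^ i * real (card (monic_divisors g i)))"
    unfolding of_nat_sum sum_divide_distrib by (intro sum.cong refl scale) auto
  \<comment> \<open>Below degree \<open>k\<close> there are no nonconstant divisors; the term
    \<open>i = k\<close> is then split off as the main term.\<close>
  also have "\<dots> = (\<Sum>i=k..d. real i / real q ^ i * real (card (monic_divisors g i)))"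
    using k monic_divisors_below_min_degree[OF g kmin] by (intro sum.mono_neutral_right) auto
  also have "\<dots> = real k * real lamstar / real q ^ k
      + (\<Sum>i=k+1..d. real i / real q ^ i * real (card (monic_divisors g i)))"
    using assms(8,9) k monic_divisors_min_degree[OF g kmin] by (simp add: sum.atLeast_Suc_atMost)
  also have "\<dots> \<le> real k * real lamstar / real q ^ k + (\<Sum>i=k+1..d. real i / real q ^ i * ?B i)"
  proof (intro add_left_mono sum_mono mult_left_mono)
    fix i assume i: "i \<in> {k+1..d}"
    have "card (monic_divisors g i) \<le> (\<Sum>h\<in>sub_patterns lam k i. \<Prod>j=k..i. lam j choose h j)"
      \<comment> \<open>From \<open>1 \<le> k\<close> and \<open>i \<le> d < e\<close>, all indices
        in \<open>{k..i}\<close> lie in \<open>{1..e}\<close>, where \<open>lam\<close> is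
        prescribed.\<close>
      using i k assms(3) by (intro card_monic_divisors_le g kmin lam) auto
    from of_nat_mono[OF this, where ?'a = real]
    show "real (card (monic_divisors g i)) \<le> ?B i" by simp
  qed auto
  finally have upper: "?E \<le> real k * real lamstar / real q ^ k + (\<Sum>i=k+1..d. real i / real q ^ i * ?B i)" .

  \<comment> \<open>Subtracting a nonnegative quantity only weakens \<open>lower\<close>.\<close>
  have "0 \<le> real (lamstar choose 2) * (real k / real q ^ min (2 * k) d)" by simp
  with lower upper show ?thesis unfolding M_def by linarith
qed

end
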